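(* For every integers $n, C$ with $C\ge 2$, $n\ge 2C$ and $n$ even, there is a graph $G$ on $N=C^n$ vertices that is missing at most $N^{g}$ edges (i.e. $\binom N2-|E(G)|\le N^g$), for $$g = 2-\frac{1}{2C^4\ln C}+o(1),$$ and whose edges can be covered by $N^{f}$ pairwise edge-disjoint induced matchings of $G$, where $$f = 1+\frac{2\ln 10.5}{\ln C}+o(1).$$
   Context: An induced matching in a graph $G$ is a set of pairwise vertex-disjoint edges of $G$ such that the subgraph of $G$ induced on the set of endpoints of these edges contains no other edges. The $o(1)$ terms tend to $0$ as $n\to\infty$ with $C$ fixed. *)

theory Defs
  imports Complex_Main "HOL-Library.Disjoint_Sets" "HOL-Library.Ramsey"
begin

definition finite_simple_graph :: "'a set \<Rightarrow> 'a set set \<Rightarrow> bool" where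
  "finite_simple_graph V E \<longleftrightarrow> finite V \<and> E \<subseteq> [V]\<^bsup>2\<^esup>"

definition induced_edges :: "'a set set \<Rightarrow> 'a set \<Rightarrow> 'a set set" where
  "induced_edges E S = {e \<in> E. e \<subseteq> S}"

definition induced_matching :: "'a set set \<Rightarrow> 'a set set \<Rightarrow> bool" where
  "induced_matching E M \<longleftrightarrow> M \<subseteq> E \<and> disjoint M \<and> induced_edges E (\<Union>M) = M"

text \<open>
  In \<open>covered_by_induced_matchings\<close>, \<open>disjoint \<M>\<close> says that distinct matchings share
  no edge; different matchings may share vertices.
\<close>

definition covered_by_induced_matchings :: "'a set set \<Rightarrow> 'a set set set \<Rightarrow> bool" where
  "covered_by_induced_matchings E \<M> \<longleftrightarrow>
     finite \<M> \<and> (\<forall>M\<in>\<M>. induced_matching E M) \<and> disjoint \<M> \<and> E \<subseteq> \<Union>\<M>"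

end

theory Submission
  imports Defs
begin

text \<open>
  The vertices are the points of the grid \<open>[C]\<^sup>n\<close>, and \<open>x\<close>, \<open>y\<close> are adjacent iff \<open>|x - y|\<^sup>2\<close> differs
  from its average by at most \<open>2n\<close>. An exponential moment estimate shows that few pairs are
  non-adjacent. The edges with a given sum \<open>x + y = w\<close> form a matching, all of whose endpoints lie
  in a thin shell around \<open>w / 2\<close>. Two adjacent points of that shell are nearly antipodal, so a point
  has at most \<open>48\<^sup>n\<close> neighbours among the endpoints, and a greedy colouring splits the matching into
  \<open>2 \<cdot> 48\<^sup>n + 1\<close> induced ones. Summing over the at most \<open>(2C)\<^sup>n\<close> values of \<open>w\<close> gives about
  \<open>C\<^sup>n \<cdot> 96\<^sup>n\<close> matchings, and \<open>96 < 10.5\<^sup>2\<close>.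
\<close>

section \<open>Splitting labelled edges into induced matchings\<close>

text \<open>Induct on \<open>A\<close>: the inserted element conflicts with at most \<open>d\<close>
  others, so one of the \<open>d + 1\<close> colours in \<open>{..d}\<close> is still free for
  it.\<close>

lemma greedy_coloring:
  fixes R :: "'a \<Rightarrow> 'a \<Rightarrow> bool"
  assumes "finite A" and sym: "\<And>a b. R a b \<Longrightarrow> R b a"
    and deg: "\<And>a. a \<in> A \<Longrightarrow> card {b \<in> A. R a b} \<le> d"
  shows "\<exists>c. c ` A \<subseteq> {..d} \<and> (\<forall>a\<in>A. \<forall>b\<in>A. R a b \<and> a \<noteq> b \<longrightarrow> c a \<noteq> c b)"
  using assms(1,3)
proof (induction A rule: finite_induct)
  case empty
  then show ?case by auto
next
  case (insert x A)
  have "card {b \<in> A. R a b} \<le> d" if "a \<in> A" for a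
  proof -
    have "card {b \<in> A. R a b} \<le> card {b \<in> insert x A. R a b}"
      using insert.hyps by (intro card_mono) auto
    then show ?thesis using insert.prems[of a] that by simp
  qed
  then obtain c where c: "c ` A \<subseteq> {..d}" "\<forall>a\<in>A. \<forall>b\<in>A. R a b \<and> a \<noteq> b \<longrightarrow> c a \<noteq> c b"
    using insert.IH by blast
  let ?B = "{b \<in> A. R x b}"
  have "card (c ` ?B) \<le> card ?B" using insert.hyps by (intro card_image_le) auto
  also have "\<dots> \<le> card {b \<in> insert x A. R x b}" using insert.hyps by (intro card_mono) auto
  also have "\<dots> \<le> d" using insert.prems by simp
  finally have "card (c ` ?B) < card {..d}" by simp
  then have "\<not> {..d} \<subseteq> c ` ?B"
    using card_mono[of "c ` ?B" "{..d}"] insert.hyps(1) by auto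
  then obtain k where k: "k \<le> d" "k \<notin> c ` ?B" by auto
  show ?case
    by (rule exI[of _ "c(x := k)"]) (use c k insert.hyps sym in \<open>auto simp: image_subset_iff\<close>)
qed

text \<open>Edges with a common label form a matching, which fails to be induced only where an edge
  of \<open>E\<close> joins two of its members. Such members are declared in conflict, and a greedy
  colouring with \<open>d + 1\<close> colours cuts each label class into pieces free of
  conflicts.\<close>

lemma covered_by_induced_matchings_of_labelling:
  fixes lab :: "'a set \<Rightarrow> 'b"
  assumes "finite E" and E2: "E \<subseteq> [V]\<^bsup>2\<^esup>" and W: "finite W" "lab ` E \<subseteq> W"
    and disj: "\<And>e e'. e \<in> E \<Longrightarrow> e' \<in> E \<Longrightarrow> lab e = lab e' \<Longrightarrow> e \<noteq> e' \<Longrightarrow> e \<inter> e' = {}"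
    and deg: "\<And>e. e \<in> E \<Longrightarrow>
      card {e' \<in> E. lab e' = lab e \<and> e' \<noteq> e \<and> (\<exists>u\<in>e. \<exists>v\<in>e'. {u, v} \<in> E)} \<le> d"
  shows "\<exists>\<M>. covered_by_induced_matchings E \<M> \<and> card \<M> \<le> card W * Suc d"
proof -
  define R where "R e e' \<longleftrightarrow> lab e' = lab e \<and> e' \<noteq> e \<and> (\<exists>u\<in>e. \<exists>v\<in>e'. {u, v} \<in> E)" for e e'
  have symR: "R e' e" if "R e e'" for e e'
    using that unfolding R_def by (metis insert_commute)
  obtain c where c: "c ` E \<subseteq> {..d}" "\<forall>e\<in>E. \<forall>e'\<in>E. R e e' \<and> e \<noteq> e' \<longrightarrow> c e \<noteq> c e'"
    using greedy_coloring[of E R d, OF \<open>finite E\<close> symR] deg unfolding R_def by blast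
  define cls where "cls = (\<lambda>(w, k). {e \<in> E. lab e = w \<and> c e = k})"
  define \<M> where "\<M> = cls ` (W \<times> {..d})"
  have "induced_matching E (cls (w, k))" for w k
  proof -
    have "e \<in> cls (w, k)" if "e \<in> E" and sub: "e \<subseteq> \<Union> (cls (w, k))" for e
    proof -
      obtain u v where uv: "e = {u, v}" "u \<noteq> v"
        using \<open>e \<in> E\<close> E2 by (metis nsets2_E subsetD)
      then obtain a b where ab: "a \<in> cls (w, k)" "b \<in> cls (w, k)" "u \<in> a" "v \<in> b"
        using sub by auto
      have "R a b \<Longrightarrow> a \<noteq> b" unfolding R_def by blast
      then have "\<not> R a b" using c(2) ab(1,2) unfolding cls_def by blast
      \<comment> \<open>If \<open>a \<noteq> b\<close>, the edge \<open>e\<close> itself would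
        witness the conflict \<open>R a b\<close>. So both ends of \<open>e\<close> lie in one
        two-element set \<open>a\<close>, which must be \<open>e\<close>.\<close>
      then have "a = b" using ab uv \<open>e \<in> E\<close> unfolding R_def cls_def by auto
      have "card a = 2" using ab(1) E2 unfolding cls_def nsets_def by auto
      then have "a = e" using ab uv \<open>a = b\<close> by (auto simp: card_2_iff)
      then show ?thesis using ab by simp
    qed
    then show ?thesis
      unfolding induced_matching_def induced_edges_def
      using disj by (auto simp: cls_def disjoint_def)
  qed
  moreover have "disjoint \<M>"
    unfolding \<M>_def cls_def disjoint_def by auto
  moreover have "E \<subseteq> \<Union> \<M>"
    using W c(1) unfolding \<M>_def cls_def by (auto simp: image_subset_iff)
  moreover have "finite \<M>" using W by (simp add: \<M>_def)
  ultimately have "covered_by_induced_matchings E \<M>"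
    unfolding covered_by_induced_matchings_def by (auto simp: \<M>_def)
  moreover have "card \<M> \<le> card W * Suc d"
    unfolding \<M>_def using card_image_le[of "W \<times> {..d}" cls] W by (simp add: card_cartesian_product)
  ultimately show ?thesis by blast
qed

section \<open>Exponential moments and tail bounds\<close>

text \<open>Meant for quantities of mean zero: on averaging, the linear term vanishes and only the
  square remains.\<close>

lemma exp_le_quadratic:
  fixes x :: real
  assumes "\<bar>x\<bar> \<le> 1"
  shows "exp x \<le> 1 + x + x\<^sup>2"
proof (cases "x \<ge> 0")
  case True
  then show ?thesis using assms exp_bound by simp
next
  case False
  define y where "y = - x"
  have y: "0 \<le> y" "y \<le> 1" using False assms by (auto simp: y_def)
  have pos: "0 \<le> 1 - y + y\<^sup>2" using y by simp
  \<comment> \<open>It suffices that \<open>(1 - y + y\<^sup>2) * exp y\<close> is at least 1. With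
    \<open>exp y\<close> replaced by its quadratic Taylor polynomial, the linear term of the product
    cancels and the others are nonnegative.\<close>
  have "1 \<le> 1 + y\<^sup>2 / 2 + y ^ 3 / 2 + y ^ 4 / 2" using y by simp
  also have "\<dots> = (1 - y + y\<^sup>2) * (1 + y + y\<^sup>2 / 2)"
    by (simp add: field_simps power2_eq_square power3_eq_cube power4_eq_xxxx)
  also have "\<dots> \<le> (1 - y + y\<^sup>2) * exp y"
    by (rule mult_left_mono[OF exp_lower_Taylor_quadratic[OF y(1)] pos])
  finally have "exp (- y) \<le> 1 - y + y\<^sup>2" by (simp add: exp_minus field_simps)
  then show ?thesis by (simp add: y_def)
qed

text \<open>Independence of the coordinates: distributivity is applied first to \<open>g\<close>,
  then to \<open>f\<close>.\<close>

lemma sum_prod_pairs_PiE: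
  fixes h :: "'a \<Rightarrow> 'a \<Rightarrow> 'c :: comm_semiring_1"
  assumes "finite I" "finite A"
  shows "(\<Sum>f\<in>I \<rightarrow>\<^sub>E A. \<Sum>g\<in>I \<rightarrow>\<^sub>E A. \<Prod>i\<in>I. h (f i) (g i)) = (\<Sum>a\<in>A. \<Sum>b\<in>A. h a b) ^ card I"
proof -
  have "(\<Sum>f\<in>I \<rightarrow>\<^sub>E A. \<Sum>g\<in>I \<rightarrow>\<^sub>E A. \<Prod>i\<in>I. h (f i) (g i))
      = (\<Sum>f\<in>I \<rightarrow>\<^sub>E A. \<Prod>i\<in>I. \<Sum>b\<in>A. h (f i) b)"
    using assms by (simp add: prod_sum_PiE)
  also have "\<dots> = (\<Prod>i\<in>I. \<Sum>a\<in>A. \<Sum>b\<in>A. h a b)"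
    using assms prod_sum_PiE[of I "\<lambda>_. A" "\<lambda>_ a. \<Sum>b\<in>A. h a b"] by simp
  finally show ?thesis by simp
qed

text \<open>Chernoff's bound for independent uniform \<open>f\<close> and \<open>g\<close>, with
  exponential parameter 1; other parameters are reached by scaling \<open>h\<close>. The moment
  factors over \<open>I\<close>, and since \<open>h\<close> has mean zero each factor averages at
  most \<open>1 + s \<le> exp s\<close>.\<close>

lemma card_pairs_upper_tail:
  fixes h :: "'a \<Rightarrow> 'a \<Rightarrow> real" and s t :: real
  assumes fin: "finite I" "finite A"
    and bounded: "\<And>a b. a \<in> A \<Longrightarrow> b \<in> A \<Longrightarrow> \<bar>h a b\<bar> \<le> 1"
    and mean: "(\<Sum>a\<in>A. \<Sum>b\<in>A. h a b) = 0"
    and var: "\<And>a b. a \<in> A \<Longrightarrow> b \<in> A \<Longrightarrow> (h a b)\<^sup>2 \<le> s"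
  shows "real (card {(f, g) \<in> (I \<rightarrow>\<^sub>E A) \<times> (I \<rightarrow>\<^sub>E A). (\<Sum>i\<in>I. h (f i) (g i)) \<ge> card I * t})
    \<le> (real (card A) ^ card I)\<^sup>2 * exp (card I * (s - t))"
proof -
  let ?F = "I \<rightarrow>\<^sub>E A"
  let ?S = "\<lambda>(f, g). \<Sum>i\<in>I. h (f i) (g i)"
  let ?B = "{p \<in> ?F \<times> ?F. ?S p \<ge> card I * t}"
  have finF: "finite ?F" using fin by (simp add: finite_PiE)
  \<comment> \<open>Markov's inequality for the exponential of the sum.\<close>
  have "real (card ?B) * exp (card I * t) = (\<Sum>p\<in>?B. exp (card I * t))" by simp
  also have "\<dots> \<le> (\<Sum>p\<in>?B. exp (?S p))" by (intro sum_mono) auto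
  also have "\<dots> \<le> (\<Sum>p\<in>?F \<times> ?F. exp (?S p))" using finF by (intro sum_mono2) auto
  also have "\<dots> = (\<Sum>f\<in>?F. \<Sum>g\<in>?F. \<Prod>i\<in>I. exp (h (f i) (g i)))"
    using fin by (simp add: sum.cartesian_product exp_sum case_prod_unfold)
  also have "\<dots> = (\<Sum>a\<in>A. \<Sum>b\<in>A. exp (h a b)) ^ card I"
    using sum_prod_pairs_PiE[OF fin] .
  also have "\<dots> \<le> ((real (card A))\<^sup>2 * exp s) ^ card I"
  proof (rule power_mono)
    have "(\<Sum>a\<in>A. \<Sum>b\<in>A. exp (h a b)) \<le> (\<Sum>a\<in>A. \<Sum>b\<in>A. h a b + (1 + s))"
    proof (intro sum_mono)
      fix a b assume "a \<in> A" "b \<in> A"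
      then show "exp (h a b) \<le> h a b + (1 + s)"
        using exp_le_quadratic[OF bounded] var by (smt (verit))
    qed
    also have "\<dots> = (real (card A))\<^sup>2 * (1 + s)"
      using mean by (simp add: sum.distrib power2_eq_square)
    also have "\<dots> \<le> (real (card A))\<^sup>2 * exp s" by (intro mult_left_mono) auto
    finally show "(\<Sum>a\<in>A. \<Sum>b\<in>A. exp (h a b)) \<le> (real (card A))\<^sup>2 * exp s" .
  qed (intro sum_nonneg, simp)
  also have "\<dots> = (real (card A) ^ card I)\<^sup>2 * exp (card I * s)"
    by (simp add: power_mult_distrib exp_of_nat_mult power_mult[symmetric] mult.commute[of 2])
  finally have "real (card ?B) \<le> (real (card A) ^ card I)\<^sup>2 * exp (card I * s) / exp (card I * t)"
    by (simp add: pos_le_divide_eq)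
  then show ?thesis
    by (simp add: right_diff_distrib exp_diff case_prod_unfold mem_Times_iff)
qed

section \<open>Lattice points in l1 balls\<close>

lemma sum_half_power_le:
  assumes "finite T"
  shows "(\<Sum>i\<in>T. (1 / 2 :: real) ^ i) \<le> 2"
  using sum_le_suminf[of "\<lambda>i. (1 / 2 :: real) ^ i" T] assms
  by (simp add: suminf_geometric summable_geometric)

text \<open>Two geometric series: integers from \<open>k\<close> upwards contribute at most 2, those
  below \<open>k\<close> at most 1.\<close>

lemma sum_half_power_abs_diff_le:
  fixes S :: "int set"
  assumes "finite S"
  shows "(\<Sum>j\<in>S. (1 / 2 :: real) ^ nat \<bar>j - k\<bar>) \<le> 3"
proof -
  let ?U = "{j \<in> S. k \<le> j}" and ?L = "{j \<in> S. j < k}"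
  have "(\<Sum>j\<in>?U. (1 / 2 :: real) ^ nat \<bar>j - k\<bar>) = (\<Sum>i\<in>(\<lambda>j. nat (j - k)) ` ?U. (1 / 2) ^ i)"
    by (subst sum.reindex) (auto simp: inj_on_def)
  also have "\<dots> \<le> 2" using assms by (intro sum_half_power_le) auto
  finally have U: "(\<Sum>j\<in>?U. (1 / 2 :: real) ^ nat \<bar>j - k\<bar>) \<le> 2" .
  have half: "(1 / 2 :: real) ^ nat \<bar>j - k\<bar> = 1 / 2 * (1 / 2) ^ nat (k - j - 1)" if "j < k" for j
  proof -
    have "nat \<bar>j - k\<bar> = Suc (nat (k - j - 1))" using that by simp
    then show ?thesis by simp
  qed
  have "(\<Sum>j\<in>?L. (1 / 2 :: real) ^ nat \<bar>j - k\<bar>) = (\<Sum>j\<in>?L. 1 / 2 * (1 / 2) ^ nat (k - j - 1))"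
    by (intro sum.cong refl half) simp
  also have "\<dots> = 1 / 2 * (\<Sum>i\<in>(\<lambda>j. nat (k - j - 1)) ` ?L. (1 / 2) ^ i)"
    by (subst sum.reindex) (auto simp: inj_on_def sum_distrib_left)
  also have "\<dots> \<le> 1 / 2 * 2" using assms by (intro mult_left_mono sum_half_power_le) auto
  finally have L: "(\<Sum>j\<in>?L. (1 / 2 :: real) ^ nat \<bar>j - k\<bar>) \<le> 1" by simp
  have "S = ?U \<union> ?L" by auto
  then have "(\<Sum>j\<in>S. (1 / 2 :: real) ^ nat \<bar>j - k\<bar>)
      = (\<Sum>j\<in>?U. (1 / 2 :: real) ^ nat \<bar>j - k\<bar>) + (\<Sum>j\<in>?L. (1 / 2 :: real) ^ nat \<bar>j - k\<bar>)"
    using assms sum.union_disjoint[of ?U ?L "\<lambda>j. (1 / 2 :: real) ^ nat \<bar>j - k\<bar>"] by fastforce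
  then show ?thesis using U L by simp
qed

text \<open>The bound is independent of \<open>A\<close>, hence of the side of the grid; this is
  what makes the base 48 in the degree bound an absolute constant.\<close>

lemma card_l1_ball_PiE_le:
  fixes k :: "'i \<Rightarrow> int" and A :: "nat set"
  assumes fin: "finite I" "finite A"
  shows "card {g \<in> I \<rightarrow>\<^sub>E A. (\<Sum>i\<in>I. \<bar>int (g i) - k i\<bar>) \<le> int r} \<le> 2 ^ r * 3 ^ card I"
proof -
  let ?F = "I \<rightarrow>\<^sub>E A"
  let ?B = "{g \<in> ?F. (\<Sum>i\<in>I. \<bar>int (g i) - k i\<bar>) \<le> int r}"
  have finF: "finite ?F" using fin by (simp add: finite_PiE)
  \<comment> \<open>Weighting \<open>g\<close> by \<open>2\<close> to the minus its distance from \<open>k\<close> makes the count factor over coordinates.\<close>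
  have "real (card ?B) * (1 / 2) ^ r = (\<Sum>g\<in>?B. (1 / 2) ^ r)" by simp
  also have "\<dots> \<le> (\<Sum>g\<in>?B. \<Prod>i\<in>I. (1 / 2 :: real) ^ nat \<bar>int (g i) - k i\<bar>)"
  proof (rule sum_mono)
    fix g assume "g \<in> ?B"
    then have "int (\<Sum>i\<in>I. nat \<bar>int (g i) - k i\<bar>) \<le> int r" by simp
    then have "(\<Sum>i\<in>I. nat \<bar>int (g i) - k i\<bar>) \<le> r" by linarith
    then show "(1 / 2) ^ r \<le> (\<Prod>i\<in>I. (1 / 2 :: real) ^ nat \<bar>int (g i) - k i\<bar>)"
      by (simp add: power_sum[symmetric] power_decreasing)
  qed
  also have "\<dots> \<le> (\<Sum>g\<in>?F. \<Prod>i\<in>I. (1 / 2 :: real) ^ nat \<bar>int (g i) - k i\<bar>)"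
    using finF by (intro sum_mono2) (auto intro: prod_nonneg)
  also have "\<dots> = (\<Prod>i\<in>I. \<Sum>b\<in>A. (1 / 2 :: real) ^ nat \<bar>int b - k i\<bar>)"
    using fin by (simp add: prod_sum_PiE)
  also have "\<dots> \<le> (\<Prod>i\<in>I. 3)"
  proof (intro prod_mono conjI)
    fix i assume "i \<in> I"
    have "(\<Sum>b\<in>A. (1 / 2 :: real) ^ nat \<bar>int b - k i\<bar>) = (\<Sum>j\<in>int ` A. (1 / 2) ^ nat \<bar>j - k i\<bar>)"
      by (simp add: sum.reindex)
    then show "(\<Sum>b\<in>A. (1 / 2 :: real) ^ nat \<bar>int b - k i\<bar>) \<le> 3"
      using sum_half_power_abs_diff_le[of "int ` A" "k i"] fin by simp
  qed (simp add: sum_nonneg)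
  finally have "real (card ?B) \<le> 2 ^ r * 3 ^ card I"
    by (simp add: power_one_over field_simps)
  then have "real (card ?B) \<le> real (2 ^ r * 3 ^ card I)" by simp
  then show ?thesis by (simp only: of_nat_le_iff)
qed


section \<open>Distances in the grid\<close>

text \<open>For random grid points the squared distance is a sum of \<open>n\<close> independent
  terms between 0 and \<open>C\<^sup>2\<close>, so it concentrates around its mean; the leading 2
  counts the two tails.\<close>

lemma card_far_pairs_le:
  fixes C n :: nat
  assumes "C \<ge> 1"
  shows "\<exists>m. real (card {(f, g) \<in> ({..<n} \<rightarrow>\<^sub>E {..<C}) \<times> ({..<n} \<rightarrow>\<^sub>E {..<C}).
      \<bar>(\<Sum>i<n. (real (f i) - real (g i))\<^sup>2) - m\<bar> > 2 * n})
    \<le> 2 * (real C ^ n)\<^sup>2 * exp (- (n / real C ^ 4))"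
proof -
  let ?F = "{..<n} \<rightarrow>\<^sub>E {..<C}"
  let ?D = "\<lambda>f g. \<Sum>i<n. (real (f i) - real (g i))\<^sup>2"
  \<comment> \<open>The mean for a single coordinate; the witness for the claim is
    \<open>n * m\<close>.\<close>
  define m where "m = (\<Sum>a<C. \<Sum>b<C. (real a - real b)\<^sup>2) / (real C)\<^sup>2"
  have C: "real C \<ge> 1" using assms by simp
  have sq: "(real a - real b)\<^sup>2 \<le> (real C)\<^sup>2" if "a < C" "b < C" for a b
    using that by (intro power2_le_iff_abs_le[THEN iffD2]) auto
  have "(\<Sum>a<C. \<Sum>b<C. (real a - real b)\<^sup>2) \<le> (\<Sum>a<C. \<Sum>b<C. (real C)\<^sup>2)"
    using sq by (intro sum_mono) auto
  also have "\<dots> = (real C)\<^sup>2 * (real C)\<^sup>2" by (simp add: power2_eq_square)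
  finally have m1: "m \<le> (real C)\<^sup>2" using C by (simp add: m_def divide_le_eq)
  have m0: "0 \<le> m" unfolding m_def by (intro divide_nonneg_nonneg sum_nonneg) auto
  \<comment> \<open>The sign \<open>\<sigma>\<close> selects the upper or the lower tail.\<close>
  have tail: "real (card {(f, g) \<in> ?F \<times> ?F. \<sigma> * (?D f g - n * m) \<ge> 2 * n})
      \<le> (real C ^ n)\<^sup>2 * exp (- (n / real C ^ 4))" if \<sigma>: "\<sigma> = 1 \<or> \<sigma> = -1" for \<sigma> :: real
  proof -
    \<comment> \<open>A scaling factor \<open>c\<close> yields \<open>s = c\<^sup>2 * C ^ 4\<close>
      and \<open>t = 2 * c\<close> in the Chernoff bound; \<open>c = 1 / C ^ 4\<close> maximises
      \<open>t - s\<close>, with value \<open>1 / C ^ 4\<close>.\<close>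
    define h where "h a b = \<sigma> * ((real a - real b)\<^sup>2 - m) / real C ^ 4" for a b :: nat
    have h_abs: "\<bar>h a b\<bar> \<le> 1 / (real C)\<^sup>2" if "a < C" "b < C" for a b
    proof -
      have "\<bar>(real a - real b)\<^sup>2 - m\<bar> \<le> (real C)\<^sup>2"
        using sq[OF that] m0 m1 zero_le_power2[of "real a - real b"] by linarith
      then have "\<bar>h a b\<bar> \<le> (real C)\<^sup>2 / real C ^ 4"
        using \<sigma> C by (auto simp: h_def abs_mult intro!: divide_right_mono)
      also have "\<dots> = 1 / (real C)\<^sup>2" using C by (simp add: field_simps power2_eq_square power4_eq_xxxx)
      finally show ?thesis .
    qed
    have "1 / (real C)\<^sup>2 \<le> 1" using C by simp
    then have bounded: "\<bar>h a b\<bar> \<le> 1" if "a \<in> {..<C}" "b \<in> {..<C}" for a b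
      using order_trans[OF h_abs[of a b]] that by blast
    have var: "(h a b)\<^sup>2 \<le> 1 / real C ^ 4" if "a \<in> {..<C}" "b \<in> {..<C}" for a b
    proof -
      have "\<bar>h a b\<bar>\<^sup>2 \<le> (1 / (real C)\<^sup>2)\<^sup>2" using h_abs that by (intro power_mono) auto
      then show ?thesis by (simp add: power_divide)
    qed
    have "(\<Sum>a<C. \<Sum>b<C. h a b) = \<sigma> * ((\<Sum>a<C. \<Sum>b<C. (real a - real b)\<^sup>2) - (real C)\<^sup>2 * m) / real C ^ 4"
      by (simp add: h_def sum_divide_distrib[symmetric] sum_distrib_left[symmetric] sum_subtractf
          power2_eq_square)
    then have mean: "(\<Sum>a\<in>{..<C}. \<Sum>b\<in>{..<C}. h a b) = 0" using C by (simp add: m_def)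
    have sum_h: "(\<Sum>i<n. h (f i) (g i)) = \<sigma> * (?D f g - n * m) / real C ^ 4" for f g
      by (simp add: h_def sum_divide_distrib[symmetric] sum_distrib_left[symmetric] sum_subtractf)
    have "real (card {(f, g) \<in> ?F \<times> ?F. (\<Sum>i<n. h (f i) (g i)) \<ge> n * (2 / real C ^ 4)})
        \<le> (real C ^ n)\<^sup>2 * exp (n * (1 / real C ^ 4 - 2 / real C ^ 4))"
      using card_pairs_upper_tail[of "{..<n}" "{..<C}" h "1 / real C ^ 4" "2 / real C ^ 4",
          OF _ _ bounded mean var] by simp
    moreover have "(\<Sum>i<n. h (f i) (g i)) \<ge> n * (2 / real C ^ 4) \<longleftrightarrow> \<sigma> * (?D f g - n * m) \<ge> 2 * n" for f g
      using C unfolding sum_h by (simp add: divide_le_cancel mult.commute)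
    ultimately show ?thesis by (simp add: field_simps)
  qed
  let ?T = "\<lambda>\<sigma> :: real. {(f, g) \<in> ?F \<times> ?F. \<sigma> * (?D f g - n * m) \<ge> 2 * n}"
  have fin: "finite (?T \<sigma>)" for \<sigma>
    by (rule finite_subset[of _ "?F \<times> ?F"]) (auto intro!: finite_PiE)
  have "card {(f, g) \<in> ?F \<times> ?F. \<bar>?D f g - n * m\<bar> > 2 * n} \<le> card (?T 1 \<union> ?T (-1))"
  proof (rule card_mono[OF finite_UnI[OF fin fin] subsetI])
    fix p assume p: "p \<in> {(f, g) \<in> ?F \<times> ?F. \<bar>?D f g - n * m\<bar> > 2 * n}"
    obtain f g where fg: "p = (f, g)" by fastforce
    define d where "d = ?D f g - n * m"
    have "(f, g) \<in> ?F \<times> ?F" "\<bar>d\<bar> > 2 * n"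
      using p unfolding fg d_def by blast+
    moreover from this(2) have "1 * d \<ge> 2 * n \<or> -1 * d \<ge> 2 * n" by linarith
    ultimately show "p \<in> ?T 1 \<union> ?T (-1)" unfolding fg d_def by blast
  qed
  also have "\<dots> \<le> card (?T 1) + card (?T (-1))" by (rule card_Un_le)
  finally have "real (card {(f, g) \<in> ?F \<times> ?F. \<bar>?D f g - n * m\<bar> > 2 * n})
      \<le> real (card (?T 1)) + real (card (?T (-1)))" by linarith
  also have "\<dots> \<le> 2 * (real C ^ n)\<^sup>2 * exp (- (n / real C ^ 4))"
    using tail[of 1] tail[of "-1"] by linarith
  finally show ?thesis by blast
qed

text \<open>
  By the parallelogram law \<open>|f - g|\<^sup>2 + |f + g - w|\<^sup>2 = (|2f - w|\<^sup>2 + |2g - w|\<^sup>2) / 2\<close>, all these \<open>g\<close>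
  lie within distance \<open>2 \<surd>n\<close> of the antipode \<open>w - f\<close>.
\<close>
lemma card_near_antipodal_le:
  fixes f w :: "nat \<Rightarrow> nat" and m :: real
  assumes f: "(\<Sum>i<n. (2 * real (f i) - real (w i))\<^sup>2) \<le> m + 2 * n"
  shows "card {g \<in> {..<n} \<rightarrow>\<^sub>E {..<C}. (\<Sum>i<n. (2 * real (g i) - real (w i))\<^sup>2) \<le> m + 2 * n \<and>
      m - 2 * n \<le> (\<Sum>i<n. (real (f i) - real (g i))\<^sup>2)} \<le> 48 ^ n"
proof -
  let ?S = "{g \<in> {..<n} \<rightarrow>\<^sub>E {..<C}. (\<Sum>i<n. (2 * real (g i) - real (w i))\<^sup>2) \<le> m + 2 * n \<and>
      m - 2 * n \<le> (\<Sum>i<n. (real (f i) - real (g i))\<^sup>2)}"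
  \<comment> \<open>The antipode of \<open>f\<close>, integer-valued because its coordinates may be
    negative.\<close>
  define k where "k i = int (w i) - int (f i)" for i
  \<comment> \<open>The radius comes from
    \<open>(m + 2 * n) / 2 + (m + 2 * n) / 2 - (m - 2 * n) = 4 * n\<close>.\<close>
  let ?B = "{g \<in> {..<n} \<rightarrow>\<^sub>E {..<C}. (\<Sum>i<n. \<bar>int (g i) - k i\<bar>) \<le> int (4 * n)}"
  have "?S \<subseteq> ?B"
  proof (intro subsetI CollectI conjI)
    fix g assume g: "g \<in> ?S"
    then show "g \<in> {..<n} \<rightarrow>\<^sub>E {..<C}" by simp
    \<comment> \<open>Integrality lets the squared Euclidean distance dominate the l1
      distance.\<close>
    have le_sq: "\<bar>z\<bar> \<le> z\<^sup>2" for z :: int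
      using self_le_power[of "\<bar>z\<bar>" 2] by (cases "z = 0") auto
    have "real_of_int (\<Sum>i<n. \<bar>int (g i) - k i\<bar>) \<le> real_of_int (\<Sum>i<n. (int (g i) - k i)\<^sup>2)"
      unfolding of_int_le_iff by (intro sum_mono le_sq)
    also have "\<dots> = (\<Sum>i<n. (real (f i) + real (g i) - real (w i))\<^sup>2)"
      by (simp add: k_def algebra_simps)
    also have "\<dots> = (\<Sum>i<n. (2 * real (f i) - real (w i))\<^sup>2 / 2 + (2 * real (g i) - real (w i))\<^sup>2 / 2
        - (real (f i) - real (g i))\<^sup>2)"
      by (intro sum.cong refl) (simp add: power2_eq_square field_simps)
    also have "\<dots> = (\<Sum>i<n. (2 * real (f i) - real (w i))\<^sup>2) / 2
        + (\<Sum>i<n. (2 * real (g i) - real (w i))\<^sup>2) / 2 - (\<Sum>i<n. (real (f i) - real (g i))\<^sup>2)"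
      by (simp add: sum.distrib sum_subtractf sum_divide_distrib)
    also have "\<dots> \<le> 4 * n" using f g by simp
    finally show "(\<Sum>i<n. \<bar>int (g i) - k i\<bar>) \<le> int (4 * n)" by linarith
  qed
  then have "card ?S \<le> card ?B" by (intro card_mono) (auto intro!: finite_PiE)
  also have "\<dots> \<le> 2 ^ (4 * n) * 3 ^ n" using card_l1_ball_PiE_le[of "{..<n}" "{..<C}" k "4 * n"] by simp
  also have "\<dots> = 48 ^ n" by (simp add: power_mult power_mult_distrib[symmetric])
  finally show ?thesis .
qed

section \<open>The graph and its induced matchings\<close>

text \<open>The quantitative form, before passing to exponents of \<open>N\<close>: at most
  \<open>(2 * C) ^ n\<close> sums occur as labels, and each label class splits into
  \<open>2 * 48 ^ n + 1\<close> pieces.\<close>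

lemma nearly_complete_graph_with_induced_matchings:
  fixes C n :: nat
  assumes "C \<ge> 1"
  defines "N \<equiv> C ^ n"
  shows "\<exists>(V :: nat set) E \<M>. finite_simple_graph V E \<and> card V = N \<and>
    real (N choose 2) - real (card E) \<le> 2 * (real N)\<^sup>2 * exp (- (n / real C ^ 4)) \<and>
    covered_by_induced_matchings E \<M> \<and> card \<M> \<le> (2 * C) ^ n * Suc (2 * 48 ^ n)"
proof -
  let ?F = "{..<n} \<rightarrow>\<^sub>E {..<C}"
  let ?D = "\<lambda>f g. \<Sum>i<n. (real (f i) - real (g i))\<^sup>2"
  define V where "V = {..<N}"
  have "finite ?F" by (simp add: finite_PiE)
  have "card ?F = N" by (simp add: card_PiE N_def)
  \<comment> \<open>Grid points are renamed as natural numbers, and \<open>\<phi>\<close> recovers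
    the coordinates.\<close>
  then obtain \<phi> where \<phi>: "bij_betw \<phi> V ?F"
    using finite_same_card_bij[of V ?F] \<open>finite ?F\<close> by (auto simp: V_def)
  have inj: "inj_on \<phi> V" using \<phi> by (simp add: bij_betw_def)
  have \<phi>F: "\<phi> x \<in> ?F" if "x \<in> V" for x using \<phi> that by (auto simp: bij_betw_def)
  obtain m where m: "real (card {(f, g) \<in> ?F \<times> ?F. \<bar>?D f g - m\<bar> > 2 * n})
      \<le> 2 * (real C ^ n)\<^sup>2 * exp (- (n / real C ^ 4))"
    using card_far_pairs_le[OF assms(1), of n] by blast
  define P where "P x y \<longleftrightarrow> \<bar>?D (\<phi> x) (\<phi> y) - m\<bar> \<le> 2 * n" for x y
  have D_comm: "?D f g = ?D g f" for f g by (simp add: power2_commute)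
  have P_sym: "P x y \<Longrightarrow> P y x" for x y unfolding P_def by (subst D_comm)
  define E where "E = {{x, y} |x y. x \<in> V \<and> y \<in> V \<and> x \<noteq> y \<and> P x y}"
  have E_iff: "{x, y} \<in> E \<longleftrightarrow> x \<in> V \<and> y \<in> V \<and> x \<noteq> y \<and> P x y" for x y
    unfolding E_def using P_sym by (auto simp: doubleton_eq_iff)
  have E_sub: "E \<subseteq> [V]\<^bsup>2\<^esup>" unfolding E_def by auto
  have finV: "finite V" by (simp add: V_def)
  have fin2: "finite ([V]\<^bsup>2\<^esup>)" using finV by (rule finite_imp_finite_nsets)
  have finE: "finite E" using E_sub fin2 by (rule finite_subset)

  \<comment> \<open>Missing edges are bounded by ordered non-adjacent pairs, a harmless overcount
    that matches the tail estimate.\<close>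
  let ?Q = "{(x, y) \<in> V \<times> V. \<not> P x y}"
  have finQ: "finite ?Q" by (rule finite_subset[of _ "V \<times> V"]) (use finV in auto)
  have "[V]\<^bsup>2\<^esup> - E \<subseteq> (\<lambda>(x, y). {x, y}) ` ?Q"
  proof
    fix e assume "e \<in> [V]\<^bsup>2\<^esup> - E"
    then obtain x y where "e = {x, y}" "x \<in> V" "y \<in> V" "\<not> P x y"
      by (metis DiffE E_iff nsets2_E)
    then show "e \<in> (\<lambda>(x, y). {x, y}) ` ?Q" by (auto intro!: image_eqI[of _ _ "(x, y)"])
  qed
  then have "card ([V]\<^bsup>2\<^esup> - E) \<le> card ?Q" using finQ by (rule surj_card_le[rotated])
  also have "\<dots> \<le> card {(f, g) \<in> ?F \<times> ?F. \<bar>?D f g - m\<bar> > 2 * n}"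
  proof (rule card_inj_on_le)
    show "inj_on (map_prod \<phi> \<phi>) ?Q"
      using map_prod_inj_on[OF inj inj] by (rule inj_on_subset) auto
    show "map_prod \<phi> \<phi> ` ?Q \<subseteq> {(f, g) \<in> ?F \<times> ?F. \<bar>?D f g - m\<bar> > 2 * n}"
      using \<phi>F by (auto simp: P_def)
    show "finite {(f, g) \<in> ?F \<times> ?F. \<bar>?D f g - m\<bar> > 2 * n}"
      by (rule finite_subset[of _ "?F \<times> ?F"]) (use \<open>finite ?F\<close> in auto)
  qed
  finally have "real (card ([V]\<^bsup>2\<^esup> - E)) \<le> 2 * (real N)\<^sup>2 * exp (- (n / real C ^ 4))"
    using m by (simp add: N_def)
  moreover have "card ([V]\<^bsup>2\<^esup> - E) = (N choose 2) - card E"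
    using card_Diff_subset[OF finE E_sub] unfolding binomial_eq_nsets V_def atLeast0LessThan .
  ultimately have missing: "real (N choose 2) - real (card E) \<le> 2 * (real N)\<^sup>2 * exp (- (n / real C ^ 4))"
    by linarith

  \<comment> \<open>For an edge this is the vector sum of its ends; restricting it to
    \<open>{..<n}\<close> places it in the finite set \<open>?W\<close>.\<close>
  define lab where "lab e = (\<lambda>i\<in>{..<n}. \<Sum>v\<in>e. \<phi> v i)" for e
  let ?W = "{..<n} \<rightarrow>\<^sub>E {..<2 * C}"
  have lab_pair: "lab {x, y} i = \<phi> x i + \<phi> y i" if "x \<noteq> y" "i < n" for x y i
    using that by (simp add: lab_def)
  have edgeE: "\<exists>v'. e = {v, v'} \<and> v \<noteq> v' \<and> v \<in> V \<and> v' \<in> V \<and> P v v'" if "e \<in> E" "v \<in> e" for e v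
    using that P_sym unfolding E_def by auto
  have lab_W: "lab ` E \<subseteq> ?W"
  proof (rule image_subsetI)
    fix e assume "e \<in> E"
    then obtain x y where xy: "e = {x, y}" "x \<noteq> y" "x \<in> V" "y \<in> V" unfolding E_def by auto
    have "\<phi> x i + \<phi> y i < 2 * C" if "i < n" for i
      using PiE_mem[OF \<phi>F[OF xy(3)], of i] PiE_mem[OF \<phi>F[OF xy(4)], of i] that by simp
    then show "lab e \<in> ?W" unfolding xy(1) using xy(2) by (auto simp: lab_def)
  qed
  have disj: "e \<inter> e' = {}" if ee: "e \<in> E" "e' \<in> E" "lab e = lab e'" "e \<noteq> e'" for e e'
  proof (rule ccontr)
    assume "e \<inter> e' \<noteq> {}"
    then obtain v where "v \<in> e" "v \<in> e'" by auto
    then obtain x y where x: "e = {v, x}" "v \<noteq> x" "x \<in> V" and y: "e' = {v, y}" "v \<noteq> y" "y \<in> V"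
      using edgeE[OF ee(1)] edgeE[OF ee(2)] by metis
    \<comment> \<open>The sum and one end determine the other end.\<close>
    have "\<phi> x i = \<phi> y i" if "i < n" for i
      using lab_pair[OF x(2) that] lab_pair[OF y(2) that] \<open>lab e = lab e'\<close> x(1) y(1) by simp
    then have "\<phi> x = \<phi> y" using \<phi>F[OF x(3)] \<phi>F[OF y(3)] by (intro PiE_ext) auto
    then have "x = y" using inj x(3) y(3) by (auto dest: inj_onD)
    then show False using x y \<open>e \<noteq> e'\<close> by simp
  qed
  \<comment> \<open>Here \<open>2 * \<phi> v - lab e\<close> equals the difference of the two ends
    of \<open>e\<close>, whose squared length is bounded above by adjacency.\<close>
  have endpoint: "(\<Sum>i<n. (2 * real (\<phi> v i) - real (lab e i))\<^sup>2) \<le> m + 2 * n" if ev: "e \<in> E" "v \<in> e" for e v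
  proof -
    obtain v' where v': "e = {v, v'}" "v \<noteq> v'" "P v v'" using edgeE[OF ev] by auto
    have "(\<Sum>i<n. (2 * real (\<phi> v i) - real (lab e i))\<^sup>2) = ?D (\<phi> v) (\<phi> v')"
      by (intro sum.cong refl) (simp add: v' lab_pair)
    then show ?thesis using v'(3) unfolding P_def by linarith
  qed
  \<comment> \<open>Each conflicting edge is charged to one of its ends adjacent to an end of
    \<open>e\<close>. Edges of one label are disjoint, so the charging is injective.\<close>
  have deg: "card {e' \<in> E. lab e' = lab e \<and> e' \<noteq> e \<and> (\<exists>u\<in>e. \<exists>v\<in>e'. {u, v} \<in> E)} \<le> 2 * 48 ^ n"
    (is "card ?S \<le> _") if e: "e \<in> E" for e
  proof -
    have "\<forall>e'\<in>?S. \<exists>v. v \<in> e' \<and> (\<exists>u\<in>e. {u, v} \<in> E)" by blast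
    from bchoice[OF this] obtain c where c: "\<forall>e'\<in>?S. c e' \<in> e' \<and> (\<exists>u\<in>e. {u, c e'} \<in> E)"
      by blast
    \<comment> \<open>Only two facts about the charged end are kept: it lies in the shell around
      \<open>lab e / 2\<close>, and it is far from \<open>u\<close>. Each of the two ends
      \<open>u\<close> of \<open>e\<close> then admits at most \<open>48 ^ n\<close>
      candidates.\<close>
    define Nb where "Nb u = {g \<in> ?F. (\<Sum>i<n. (2 * real (g i) - real (lab e i))\<^sup>2) \<le> m + 2 * n \<and>
      m - 2 * n \<le> (\<Sum>i<n. (real (\<phi> u i) - real (g i))\<^sup>2)}" for u
    have "e \<in> [V]\<^bsup>2\<^esup>" using e E_sub by blast
    then have card_e: "card e = 2" "finite e" unfolding nsets_def by blast+
    have cV: "c e' \<in> V" if e': "e' \<in> ?S" for e'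
    proof -
      obtain u where "{u, c e'} \<in> E" using bspec[OF c e'] by blast
      then show ?thesis by (simp add: E_iff)
    qed
    have "card ?S \<le> card (\<Union>u\<in>e. Nb u)"
    proof (rule card_inj_on_le)
      show "inj_on (\<phi> \<circ> c) ?S"
      proof (rule comp_inj_on)
        show "inj_on c ?S"
        proof (rule inj_onI)
          fix a b assume ab: "a \<in> ?S" "b \<in> ?S" "c a = c b"
          have "c a \<in> a" "c b \<in> b" using bspec[OF c ab(1)] bspec[OF c ab(2)] by simp_all
          then have "a \<inter> b \<noteq> {}" using ab(3) by auto
          moreover have "a \<in> E" "b \<in> E" "lab a = lab b" using ab by simp_all
          ultimately show "a = b" using disj by blast
        qed
        show "inj_on \<phi> (c ` ?S)" using inj by (rule inj_on_subset) (use cV in blast)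
      qed
      show "(\<phi> \<circ> c) ` ?S \<subseteq> (\<Union>u\<in>e. Nb u)"
      proof (rule image_subsetI)
        fix e' assume e': "e' \<in> ?S"
        then obtain u where u: "u \<in> e" "{u, c e'} \<in> E" "c e' \<in> e'" using bspec[OF c e'] by blast
        then have "P u (c e')" by (simp add: E_iff)
        then have "m - 2 * n \<le> ?D (\<phi> u) (\<phi> (c e'))" unfolding P_def by linarith
        moreover have "(\<Sum>i<n. (2 * real (\<phi> (c e') i) - real (lab e i))\<^sup>2) \<le> m + 2 * n"
          using endpoint[of e' "c e'"] e' u(3) by simp
        ultimately have "\<phi> (c e') \<in> Nb u" using \<phi>F[OF cV[OF e']] by (simp add: Nb_def)
        then show "(\<phi> \<circ> c) e' \<in> (\<Union>u\<in>e. Nb u)" using u(1) by auto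
      qed
      show "finite (\<Union>u\<in>e. Nb u)" using card_e \<open>finite ?F\<close> by (auto simp: Nb_def)
    qed
    also have "\<dots> \<le> (\<Sum>u\<in>e. card (Nb u))" using card_e by (intro card_UN_le)
    also have "\<dots> \<le> (\<Sum>u\<in>e. 48 ^ n)"
      unfolding Nb_def by (intro sum_mono card_near_antipodal_le endpoint e)
    finally show ?thesis using card_e by simp
  qed
  have "finite ?W" by (simp add: finite_PiE)
  then obtain \<M> where "covered_by_induced_matchings E \<M>" "card \<M> \<le> card ?W * Suc (2 * 48 ^ n)"
    using covered_by_induced_matchings_of_labelling[of E V ?W lab "2 * 48 ^ n", OF finE E_sub _ lab_W disj deg]
    by blast
  moreover have "card ?W = (2 * C) ^ n" by (simp add: card_PiE)
  moreover have "finite_simple_graph V E" using finV E_sub by (simp add: finite_simple_graph_def)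
  moreover have "card V = N" by (simp add: V_def)
  ultimately show ?thesis using missing by metis
qed

section \<open>Conversion to exponents of \<open>N\<close>\<close>

theorem theorem2p6:
  fixes C :: nat
  assumes "C \<ge> 2"
  shows "\<exists>\<epsilon> \<delta> :: nat \<Rightarrow> real.
    \<epsilon> \<longlonglongrightarrow> 0 \<and> \<delta> \<longlonglongrightarrow> 0 \<and>
    (\<forall>n::nat. n \<ge> 2 * C \<and> even n \<longrightarrow>
      (let N = C ^ n;
           g = 2 - 1 / (2 * real C ^ 4 * ln (real C)) + \<epsilon> n;
           f = 1 + 2 * ln 10.5 / ln (real C) + \<delta> n
       in \<exists>(V :: nat set) E.
            finite_simple_graph V E \<and> card V = N \<and>
            real (N choose 2) - real (card E) \<le> real N powr g \<and>
            (\<exists>\<M>. covered_by_induced_matchings E \<M> \<and> real (card \<M>) \<le> real N powr f)))"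
proof -
  define L where "L = ln (real C)"
  have L: "L > 0" using assms by (simp add: L_def)
  \<comment> \<open>Since \<open>ln N = n * L\<close>, raising \<open>N\<close> to
    \<open>\<epsilon> n\<close> gives exactly 2 and to \<open>\<delta> n\<close> exactly 3,
    absorbing the constant factors of the two bounds.\<close>
  define \<epsilon> where "\<epsilon> n = ln 2 / L / real n" for n
  define \<delta> where "\<delta> n = ln 3 / L / real n" for n
  have "\<epsilon> \<longlonglongrightarrow> 0" "\<delta> \<longlonglongrightarrow> 0"
    unfolding \<epsilon>_def \<delta>_def by (rule lim_const_over_n)+
  moreover have "\<exists>(V :: nat set) E. finite_simple_graph V E \<and> card V = C ^ n \<and>
      real (C ^ n choose 2) - real (card E) \<le> real (C ^ n) powr (2 - 1 / (2 * real C ^ 4 * L) + \<epsilon> n) \<and>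
      (\<exists>\<M>. covered_by_induced_matchings E \<M> \<and>
        real (card \<M>) \<le> real (C ^ n) powr (1 + 2 * ln 10.5 / L + \<delta> n))"
    if "n \<ge> 2 * C" for n
  proof -
    have n: "n > 0" using that assms by simp
    have powr_N: "real (C ^ n) powr a = exp (n * L * a)" for a
      using assms by (simp add: powr_def L_def ln_realpow mult_ac)
    have N_exp: "real (C ^ n) = exp (n * L)"
      using powr_N[of 1] assms by simp
    have N_sq: "(real (C ^ n))\<^sup>2 = exp (2 * (n * L))"
      unfolding N_exp by (rule exp_double[symmetric])
    obtain V :: "nat set" and E \<M> where G: "finite_simple_graph V E" "card V = C ^ n"
      "real (C ^ n choose 2) - real (card E) \<le> 2 * (real (C ^ n))\<^sup>2 * exp (- (n / real C ^ 4))"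
      "covered_by_induced_matchings E \<M>" "card \<M> \<le> (2 * C) ^ n * Suc (2 * 48 ^ n)"
      using nearly_complete_graph_with_induced_matchings[of C n] assms by auto
    note G(3)
    \<comment> \<open>The decay rate is halved to match the stated exponent.\<close>
    also have "2 * (real (C ^ n))\<^sup>2 * exp (- (n / real C ^ 4))
        \<le> 2 * (real (C ^ n))\<^sup>2 * exp (- (n / (2 * real C ^ 4)))"
      using assms by (intro mult_left_mono) (auto simp: frac_le)
    also have "\<dots> = exp (ln 2 + 2 * (n * L) - n / (2 * real C ^ 4))"
      unfolding N_sq by (simp add: exp_add exp_diff exp_minus field_simps)
    also have "ln 2 + 2 * (n * L) - n / (2 * real C ^ 4) = n * L * (2 - 1 / (2 * real C ^ 4 * L) + \<epsilon> n)"
      using L n assms by (simp add: \<epsilon>_def field_simps)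
    finally have g: "real (C ^ n choose 2) - real (card E)
        \<le> real (C ^ n) powr (2 - 1 / (2 * real C ^ 4 * L) + \<epsilon> n)"
      unfolding powr_N .
    have "real (card \<M>) \<le> real ((2 * C) ^ n * Suc (2 * 48 ^ n))"
      using G(5) by (simp only: of_nat_le_iff)
    also have "\<dots> = real (C ^ n) * (2 ^ n * (1 + 2 * 48 ^ n))"
      by (simp add: power_mult_distrib algebra_simps)
    also have "\<dots> \<le> real (C ^ n) * (2 ^ n * (3 * 48 ^ n))"
      by (intro mult_left_mono) auto
    also have "\<dots> = real (C ^ n) * (3 * 96 ^ n)"
      by (simp add: power_mult_distrib[symmetric])
    \<comment> \<open>Here \<open>96 \<le> 110.25\<close>, the square of 10.5.\<close>
    also have "\<dots> \<le> real (C ^ n) * (3 * (10.5\<^sup>2) ^ n)"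
      by (intro mult_left_mono power_mono) (auto simp: power2_eq_square)
    also have "\<dots> = exp (n * L + ln 3 + n * (2 * ln 10.5))"
      unfolding N_exp exp_add exp_of_nat_mult exp_double by simp
    also have "n * L + ln 3 + n * (2 * ln 10.5) = n * L * (1 + 2 * ln 10.5 / L + \<delta> n)"
      using L n by (simp add: \<delta>_def field_simps)
    finally have f: "real (card \<M>) \<le> real (C ^ n) powr (1 + 2 * ln 10.5 / L + \<delta> n)"
      unfolding powr_N .
    show ?thesis using G g f by blast
  qed
  ultimately show ?thesis unfolding Let_def L_def[symmetric] by blast
qed

end
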